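(* Let $\mathcal{P}$ be a finite nonempty set of token paths from $s$ to $d$ in the token multigraph, and suppose every arc function $\varphi_a$, $a\in\mathcal{A}$, is admissible, i.e. satisfies (A1)–(A4) of the context. Let $X>0$, and let $y_p$ denote the path exchange function of $p\in\mathcal{P}$. Let $\delta^*=(\delta_p^* )_{p\in\mathcal{P}}$ be an allocation, i.e. $\delta^*_p\ge 0$ for all $p\in\mathcal{P}$ and $\sum_{p\in\mathcal{P}}\delta_p^*=X$. Then $\delta^*$ is optimal for the problem $$\max_{\delta\ge 0}\ \sum_{p\in\mathcal{P}} y_p(\delta_p)\quad\text{s.t.}\quad \sum_{p\in\mathcal{P}}\delta_p=X$$ if and only if there exists $\lambda^*\in\mathbb{R}$ such that: (i) for every $p\in\mathcal{P}$ with $\delta_p^*>0$, $y_p'(\delta_p^* )=\lambda^*$; (ii) for every $p\in\mathcal{P}$ with $\delta_p^*=0$, $y_p'(0^+)\le\lambda^*$.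
   Context: Let $\mathcal{T}$ be a finite set of tokens and $\mathcal{V}$ a finite set of venues; each venue $v$ supports a set $\mathcal{E}_v\subseteq\mathcal{T}\times\mathcal{T}$ of directed tradable pairs. The token multigraph is $G_T=(\mathcal{T},\mathcal{A})$, with one directed arc $a=(i\to j;v)\in\mathcal{A}$ for each $v\in\mathcal{V}$ and each $(i,j)\in\mathcal{E}_v$ (parallel arcs are allowed). Each arc $a$ carries an exchange function $\varphi_a:\mathbb{R}_{\ge0}\to\mathbb{R}_{\ge0}$. Admissibility of $\varphi_a$ means: (A1) $\varphi_a(0)=0$; (A2) $\varphi_a$ is continuous and nondecreasing; (A3) $\varphi_a$ is concave on $\mathbb{R}_{\ge0}$; (A4) $\varphi_a$ is differentiable on $(0,\infty)$, with finite right derivative $\varphi_a'(0^+)$ at $0$. A token path from $s$ to $d$ is a sequence of arcs $p=(a_1,\dots,a_L)$, $a_\ell=(t_{\ell-1}\to t_\ell;v_\ell)$, with $t_0=s$ and $t_L=d$. Its path exchange function is $y_p=\varphi_{a_L}\circ\cdots\circ\varphi_{a_1}:\mathbb{R}_{\ge0}\to\mathbb{R}_{\ge0}$. The notation $y_p'(0^+)$ denotes the right derivative of $y_p$ at $0$. *)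

theory Defs
  imports "HOL-Analysis.Analysis" "Graph_Theory.Arc_Walk"
begin

text \<open>
  The arc \<open>(i, j, v)\<close> trades token \<open>i\<close> for token \<open>j\<close> at venue \<open>v\<close>. Keeping the venue in the arc
  is what makes parallel arcs possible.
\<close>

type_synonym ('t, 'v) arc = "'t \<times> 't \<times> 'v"

definition token_multigraph ::
    "'t set \<Rightarrow> 'v set \<Rightarrow> ('v \<Rightarrow> ('t \<times> 't) set) \<Rightarrow> ('t, ('t, 'v) arc) pre_digraph" where
  "token_multigraph T V E =
     \<lparr> verts = T,
       arcs = {(i, j, v) | i j v. v \<in> V \<and> (i, j) \<in> E v},
       tail = (\<lambda>(i, j, v). i),
       head = (\<lambda>(i, j, v). j) \<rparr>"

lemma fin_digraph_token_multigraph: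
  assumes "finite T" "finite V" "\<And>v. v \<in> V \<Longrightarrow> E v \<subseteq> T \<times> T"
  shows "fin_digraph (token_multigraph T V E)"
proof
  have "{(i, j, v) | i j v. v \<in> V \<and> (i, j) \<in> E v} \<subseteq> T \<times> T \<times> V"
    using assms(3) by auto
  then show "finite (arcs (token_multigraph T V E))"
    using assms(1,2) finite_subset by (fastforce simp: token_multigraph_def)
qed (use assms in \<open>auto simp: token_multigraph_def\<close>)

text \<open>
  Exchange functions are total functions on the reals of which only the values on \<open>{0..}\<close> matter;
  the first conjunct is the typing of the map from the nonnegative reals to themselves. The
  derivative along \<open>at_right 0\<close> is the limit of \<open>(f h - f 0) / h\<close> for \<open>h\<close> decreasing to 0.
\<close>

definition admissible :: "(real \<Rightarrow> real) \<Rightarrow> bool" where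
  "admissible f \<longleftrightarrow>
     f ` {0..} \<subseteq> {0..} \<and>
     f 0 = 0 \<and>
     continuous_on {0..} f \<and> mono_on {0..} f \<and>
     concave_on {0..} f \<and>
     (\<forall>x>0. \<exists>D. (f has_real_derivative D) (at x)) \<and>
     (\<exists>D. (f has_real_derivative D) (at_right 0))"

text \<open>
  A token path is the list of its arcs in order of traversal (\<^const>\<open>pre_digraph.awalk\<close>; arcs and
  tokens may repeat, and the empty list is a path from a token to itself, with the identity as
  exchange function).
\<close>

definition path_exchange :: "(('t, 'v) arc \<Rightarrow> real \<Rightarrow> real) \<Rightarrow> ('t, 'v) arc list \<Rightarrow> real \<Rightarrow> real" where
  "path_exchange \<phi> p = fold \<phi> p"

lemma path_exchange_Nil: "path_exchange \<phi> [] = id"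
  and path_exchange_snoc: "path_exchange \<phi> (p @ [a]) = \<phi> a \<circ> path_exchange \<phi> p"
  by (auto simp: path_exchange_def)

text \<open>Allocations are unconstrained, and irrelevant to \<open>total_output\<close>, outside \<open>P\<close>.\<close>

definition allocation :: "'p set \<Rightarrow> real \<Rightarrow> ('p \<Rightarrow> real) \<Rightarrow> bool" where
  "allocation P X \<delta> \<longleftrightarrow> (\<forall>p\<in>P. 0 \<le> \<delta> p) \<and> (\<Sum>p\<in>P. \<delta> p) = X"

definition total_output ::
    "(('t, 'v) arc \<Rightarrow> real \<Rightarrow> real) \<Rightarrow> ('t, 'v) arc list set \<Rightarrow> (('t, 'v) arc list \<Rightarrow> real) \<Rightarrow> real" where
  "total_output \<phi> P \<delta> = (\<Sum>p\<in>P. path_exchange \<phi> p (\<delta> p))"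

end

theory Submission
  imports Defs
begin

text \<open>
  Composition preserves admissibility, so every path function is concave on \<open>{0..}\<close> and
  differentiable relative to \<open>{0..}\<close>. At an optimum, shifting a little flow from a used path \<open>p\<close>
  to a path \<open>q\<close> gains nothing, so the marginal rate of \<open>q\<close> is at most that of \<open>p\<close>; hence all used
  paths share one rate, which bounds all others. Conversely, tangent lines dominate concave
  functions, and summing the tangent inequalities makes the multiplier term vanish by the
  budget constraint.
\<close>

lemma has_derivative_at_within_Ici:
  fixes f :: "real \<Rightarrow> real"
  assumes "x > 0"
  shows "(f has_real_derivative D) (at x within {0..}) \<longleftrightarrow> (f has_real_derivative D) (at x)"
proof -
  have "at x within {0..} = at x"
    by (rule at_within_interior) (use assms in \<open>simp add: interior_real_atLeast\<close>)
  then show ?thesis by simp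
qed

text \<open>Differentiability relative to \<open>{0..}\<close> merges the two-sided derivative at
  positive points with the right derivative at 0, so that compositions need no case split on whether
  a value is 0. Continuity is recovered from it.\<close>

lemma admissible_iff:
  "admissible f \<longleftrightarrow>
     f ` {0..} \<subseteq> {0..} \<and> f 0 = 0 \<and> mono_on {0..} f \<and> concave_on {0..} f \<and>
     (\<forall>x\<ge>0. \<exists>D. (f has_real_derivative D) (at x within {0..}))"
  (is "_ \<longleftrightarrow> ?R")
proof -
  have deriv: "(\<forall>x\<ge>0. \<exists>D. (f has_real_derivative D) (at x within {0..})) \<longleftrightarrow>
      (\<forall>x>0. \<exists>D. (f has_real_derivative D) (at x)) \<and>
      (\<exists>D. (f has_real_derivative D) (at_right 0))" (is "?L \<longleftrightarrow> _")
  proof -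
    have "?L \<longleftrightarrow> (\<forall>x>0. \<exists>D. (f has_real_derivative D) (at x within {0..})) \<and>
        (\<exists>D. (f has_real_derivative D) (at 0 within {0..}))"
      by (metis order_le_less order_refl)
    then show ?thesis
      by (simp add: has_derivative_at_within_Ici at_within_Ici_at_right)
  qed
  have "continuous_on {0..} f" if ?R
    using that by (intro DERIV_continuous_on[where D = "\<lambda>x. SOME D. (f has_real_derivative D) (at x within {0..})"])
      (auto intro: someI_ex)
  then show ?thesis
    unfolding admissible_def deriv[symmetric] by blast
qed

lemma admissible_id: "admissible id"
  unfolding admissible_iff
  by (auto simp: concave_on_iff mono_on_def id_def intro!: exI[of _ 1] derivative_eq_intros)

text \<open>Concavity survives because the outer function is monotone as well as concave.\<close>

lemma admissible_compose:
  assumes f: "admissible f" and g: "admissible g"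
  shows "admissible (g \<circ> f)"
  unfolding admissible_iff
proof (intro conjI allI impI)
  note f' = f[unfolded admissible_iff] and g' = g[unfolded admissible_iff]
  have f0: "f x \<ge> 0" if "x \<ge> 0" for x
    using f' that by auto
  show "(g \<circ> f) ` {0..} \<subseteq> {0..}" "(g \<circ> f) 0 = 0"
    using f' g' by auto
  have gmono: "g x \<le> g y" if "0 \<le> x" "x \<le> y" for x y
    using g' that unfolding mono_on_def by auto
  show "mono_on {0..} (g \<circ> f)"
    using f' f0 gmono by (auto simp: mono_on_def)
  show "concave_on {0..} (g \<circ> f)"
    unfolding concave_on_iff
  proof (intro conjI ballI allI impI)
    fix x y u v :: real
    assume *: "x \<in> {0..}" "y \<in> {0..}" "0 \<le> u" "0 \<le> v" "u + v = 1"
    have "u * g (f x) + v * g (f y) \<le> g (u * f x + v * f y)"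
      using g' * f0 unfolding concave_on_iff by auto
    also have "\<dots> \<le> g (f (u * x + v * y))"
      using f' * f0 unfolding concave_on_iff by (intro gmono) auto
    finally show "u * (g \<circ> f) x + v * (g \<circ> f) y \<le> (g \<circ> f) (u *\<^sub>R x + v *\<^sub>R y)"
      by simp
  qed simp
  fix x :: real
  assume x: "x \<ge> 0"
  obtain D where D: "(f has_real_derivative D) (at x within {0..})"
    using f' x by blast
  obtain D' where "(g has_real_derivative D') (at (f x) within {0..})"
    using g' f0[OF x] by blast
  \<comment> \<open>The chain rule differentiates \<open>g\<close> only along the image of
    \<open>f\<close>, which stays in \<open>{0..}\<close>; this covers \<open>f x = 0\<close> with
    \<open>x > 0\<close>.\<close>
  then have "(g has_real_derivative D') (at (f x) within f ` {0..})"
    using f' by (auto intro: DERIV_subset)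
  from DERIV_image_chain[OF this D]
  show "\<exists>D. ((g \<circ> f) has_real_derivative D) (at x within {0..})"
    by blast
qed

lemma admissible_path_exchange:
  assumes "\<And>a. a \<in> set p \<Longrightarrow> admissible (\<phi> a)"
  shows "admissible (path_exchange \<phi> p)"
  using assms
proof (induction p rule: rev_induct)
  case Nil
  then show ?case by (simp only: path_exchange_Nil admissible_id)
next
  case (snoc a p)
  then show ?case
    unfolding path_exchange_snoc by (intro admissible_compose) auto
qed

text \<open>If \<open>f z\<close> lay above the tangent at \<open>x\<close>, the chord from
  \<open>x\<close> to \<open>z\<close> would leave \<open>x\<close> more steeply than
  \<open>f\<close> and rise above it, against concavity. The point \<open>x\<close> may lie on the
  boundary of \<open>S\<close>.\<close>

lemma concave_on_le_tangent:
  fixes f :: "real \<Rightarrow> real"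
  assumes f: "concave_on S f" and x: "x \<in> S" and z: "z \<in> S"
    and D: "(f has_real_derivative D) (at x within S)"
  shows "f z \<le> f x + D * (z - x)"
proof (rule ccontr)
  assume *: "\<not> ?thesis"
  \<comment> \<open>The excess of \<open>f\<close> over its chord, with the segment from
    \<open>x\<close> to \<open>z\<close> parametrized by \<open>[0, 1]\<close>.\<close>
  define g where "g t = f (x + t * (z - x)) - f x - t * (f z - f x)" for t
  have g: "g t \<ge> 0" if "t \<in> {0..1}" for t
  proof -
    have "(1 - t) * f x + t * f z \<le> f ((1 - t) *\<^sub>R x + t *\<^sub>R z)"
      using f x z that unfolding concave_on_iff by auto
    then show ?thesis by (simp add: g_def algebra_simps)
  qed
  have "convex S"
    using f by (simp add: concave_on_iff)
  have "x + t * (z - x) \<in> S" if "t \<in> {0..1}" for t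
    using convexD_alt[OF \<open>convex S\<close> x z, of t] that by (simp add: algebra_simps)
  then have "(\<lambda>t. x + t * (z - x)) ` {0..1} \<subseteq> S"
    by auto
  then have "(f has_real_derivative D) (at (x + 0 * (z - x)) within (\<lambda>t. x + t * (z - x)) ` {0..1})"
    using D by (auto intro: DERIV_subset)
  then have "((\<lambda>t. f (x + t * (z - x))) has_real_derivative D * (z - x)) (at 0 within {0..1})"
    by (rule DERIV_image_chain[unfolded o_def]) (auto intro!: derivative_eq_intros)
  then have "(g has_real_derivative D * (z - x) - (f z - f x)) (at 0 within {0..1})"
    unfolding g_def by (auto intro!: derivative_eq_intros)
  from has_real_derivative_neg_dec_right[OF this] * obtain e
    where e: "e > 0" "\<And>h. h > 0 \<Longrightarrow> h \<in> {0..1} \<Longrightarrow> h < e \<Longrightarrow> g 0 > g h"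
    by auto
  \<comment> \<open>The cap 1 keeps \<open>h\<close> on the segment; \<open>e / 2\<close> keeps it
    strictly below \<open>e\<close>.\<close>
  define h where "h = min 1 (e / 2)"
  have "g 0 > g h" "h \<in> {0..1}"
    using e by (auto simp: h_def)
  with g[of h] show False
    by (simp add: g_def)
qed

text \<open>Moving \<open>t\<close> units from \<open>p\<close> to \<open>q\<close> changes the
  output at initial rate \<open>Dq - Dp\<close>, which optimality forbids to be positive. Only
  \<open>p\<close> must carry flow; \<open>q\<close> may be idle.\<close>

lemma optimal_marginal_le:
  fixes y :: "'p \<Rightarrow> real \<Rightarrow> real"
  assumes P: "finite P" "p \<in> P" "q \<in> P"
    and opt: "is_arg_max (\<lambda>\<delta>. \<Sum>p\<in>P. y p (\<delta> p)) (allocation P X) \<delta>"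
    and p: "\<delta> p > 0"
    and Dp: "(y p has_real_derivative Dp) (at (\<delta> p) within {0..})"
    and Dq: "(y q has_real_derivative Dq) (at (\<delta> q) within {0..})"
  shows "Dq \<le> Dp"
proof (cases "p = q")
  case True
  with Dp Dq p show ?thesis
    using DERIV_unique[of "y p" Dp "\<delta> p" Dq] by (simp add: has_derivative_at_within_Ici)
next
  case False
  show ?thesis
  proof (rule ccontr)
    assume *: "\<not> Dq \<le> Dp"
    have alloc: "allocation P X \<delta>"
      and max: "\<And>\<delta>'. allocation P X \<delta>' \<Longrightarrow> (\<Sum>p\<in>P. y p (\<delta>' p)) \<le> (\<Sum>p\<in>P. y p (\<delta> p))"
      using opt by (auto simp: is_arg_max_def not_less)
    have q: "\<delta> q \<ge> 0"
      using alloc P by (auto simp: allocation_def)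
    \<comment> \<open>\<open>g\<close> collects the two summands affected by
      \<open>shift\<close>.\<close>
    define g where "g t = y q (\<delta> q + t) + y p (\<delta> p - t)" for t
    define shift where "shift t = \<delta>(q := \<delta> q + t, p := \<delta> p - t)" for t
    have split: "(\<Sum>r\<in>P. c r) = (\<Sum>r\<in>P - {p, q}. c r) + c p + c q" for c :: "'p \<Rightarrow> real"
    proof -
      have "P - (P - {p, q}) = {p, q}"
        using P by auto
      then show ?thesis
        using sum.subset_diff[of "P - {p, q}" P c] P(1) False by auto
    qed
    have g_le: "g t \<le> g 0" if t: "t \<in> {0..\<delta> p}" for t
    proof -
      \<comment> \<open>A general \<open>c\<close> serves both the budget (\<open>c\<close> the
        identity) and the objective (\<open>c = y\<close>).\<close>
      have rest: "(\<Sum>r\<in>P - {p, q}. c r (shift t r)) = (\<Sum>r\<in>P - {p, q}. c r (\<delta> r))"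
        for c :: "'p \<Rightarrow> real \<Rightarrow> real"
        by (intro sum.cong) (auto simp: shift_def)
      have "allocation P X (shift t)"
        using alloc t q False rest[of "\<lambda>_ x. x"]
        by (auto simp: allocation_def split shift_def)
      from max[OF this] show ?thesis
        using False rest[of y] by (simp add: split g_def shift_def)
    qed
    \<comment> \<open>Shifts up to \<open>\<delta> p\<close> keep both arguments nonnegative, so the
      one-sided derivatives restrict to these images.\<close>
    have "(\<lambda>t. \<delta> q + t) ` {0..\<delta> p} \<subseteq> {0..}" "(\<lambda>t. \<delta> p - t) ` {0..\<delta> p} \<subseteq> {0..}"
      using q by auto
    then have "(y q has_real_derivative Dq) (at (\<delta> q + 0) within (\<lambda>t. \<delta> q + t) ` {0..\<delta> p})"
        "(y p has_real_derivative Dp) (at (\<delta> p - 0) within (\<lambda>t. \<delta> p - t) ` {0..\<delta> p})"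
      using Dp Dq by (auto intro: DERIV_subset)
    note chain = this[THEN DERIV_image_chain[unfolded o_def]]
    have "((\<lambda>t. y q (\<delta> q + t)) has_real_derivative Dq * 1) (at 0 within {0..\<delta> p})"
        "((\<lambda>t. y p (\<delta> p - t)) has_real_derivative Dp * (- 1)) (at 0 within {0..\<delta> p})"
      by (rule chain; auto intro!: derivative_eq_intros)+
    then have "(g has_real_derivative Dq * 1 + Dp * (- 1)) (at 0 within {0..\<delta> p})"
      unfolding g_def by (rule DERIV_add)
    from has_real_derivative_pos_inc_right[OF this] * obtain e
      where e: "e > 0" "\<And>h. h > 0 \<Longrightarrow> h \<in> {0..\<delta> p} \<Longrightarrow> h < e \<Longrightarrow> g 0 < g h"
      by auto
    define h where "h = min (\<delta> p) (e / 2)"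
    have "g 0 < g h" "h \<in> {0..\<delta> p}"
      using e p by (auto simp: h_def)
    with g_le show False
      by fastforce
  qed
qed

text \<open>The multiplier is the common marginal rate of the used paths. Derivatives within
  \<open>{0..}\<close> treat used and idle paths alike.\<close>

lemma is_arg_max_allocation_iff:
  fixes y :: "'p \<Rightarrow> real \<Rightarrow> real"
  assumes P: "finite P" and X: "X > 0" and alloc: "allocation P X \<delta>"
    and concave: "\<And>p. p \<in> P \<Longrightarrow> concave_on {0..} (y p)"
    and D: "\<And>p. p \<in> P \<Longrightarrow> (y p has_real_derivative D p) (at (\<delta> p) within {0..})"
  shows "is_arg_max (\<lambda>\<delta>. \<Sum>p\<in>P. y p (\<delta> p)) (allocation P X) \<delta> \<longleftrightarrow>
    (\<exists>l. \<forall>p\<in>P. (\<delta> p > 0 \<longrightarrow> D p = l) \<and> (\<delta> p = 0 \<longrightarrow> D p \<le> l))"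
    (is "?opt \<longleftrightarrow> (\<exists>l. ?KKT l)")
proof
  assume opt: ?opt
  \<comment> \<open>A positive budget forces a used path; its rate becomes the multiplier.\<close>
  have "\<exists>p\<in>P. \<delta> p > 0"
  proof (rule ccontr)
    assume "\<not> ?thesis"
    then have "(\<Sum>p\<in>P. \<delta> p) \<le> 0"
      by (intro sum_nonpos) (auto simp: not_less)
    with X alloc show False
      by (simp add: allocation_def)
  qed
  then obtain p0 where p0: "p0 \<in> P" "\<delta> p0 > 0"
    by blast
  have "D q \<le> D p" if "p \<in> P" "q \<in> P" "\<delta> p > 0" for p q
    using optimal_marginal_le[OF P that(1,2) opt that(3)] D that by blast
  then have "?KKT (D p0)"
    using p0 by (auto intro: antisym)
  then show "\<exists>l. ?KKT l" ..
next
  assume "\<exists>l. ?KKT l"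
  then obtain l where l: "?KKT l" ..
  have "(\<Sum>p\<in>P. y p (\<epsilon> p)) \<le> (\<Sum>p\<in>P. y p (\<delta> p))" if \<epsilon>: "allocation P X \<epsilon>" for \<epsilon>
  proof -
    have "y p (\<epsilon> p) \<le> y p (\<delta> p) + l * (\<epsilon> p - \<delta> p)" if p: "p \<in> P" for p
    proof -
      have nonneg: "\<epsilon> p \<ge> 0" "\<delta> p \<ge> 0"
        using \<epsilon> alloc p by (auto simp: allocation_def)
      have "y p (\<epsilon> p) \<le> y p (\<delta> p) + D p * (\<epsilon> p - \<delta> p)"
        using concave_on_le_tangent[OF concave[OF p] _ _ D[OF p]] nonneg by simp
      \<comment> \<open>On a used path the rates are equal; on an idle one
        \<open>\<epsilon> p - \<delta> p\<close> is nonnegative, so \<open>D p \<le> l\<close> may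
        be multiplied by it.\<close>
      also have "D p * (\<epsilon> p - \<delta> p) \<le> l * (\<epsilon> p - \<delta> p)"
        using l p nonneg by (cases "\<delta> p = 0") (auto intro: mult_right_mono)
      finally show ?thesis
        by simp
    qed
    then have "(\<Sum>p\<in>P. y p (\<epsilon> p)) \<le> (\<Sum>p\<in>P. y p (\<delta> p) + l * (\<epsilon> p - \<delta> p))"
      by (rule sum_mono)
    \<comment> \<open>Both allocations sum to \<open>X\<close>, so the term with \<open>l\<close>
      cancels.\<close>
    also have "\<dots> = (\<Sum>p\<in>P. y p (\<delta> p))"
      using \<epsilon> alloc
      by (simp add: sum.distrib sum_subtractf allocation_def flip: sum_distrib_left)
    finally show ?thesis .
  qed
  with alloc show ?opt
    by (auto simp: is_arg_max_def not_less)
qed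

theorem theorem2:
  fixes T :: "'t set" and V :: "'v set" and E :: "'v \<Rightarrow> ('t \<times> 't) set"
    and \<phi> :: "('t, 'v) arc \<Rightarrow> real \<Rightarrow> real"
    and s d :: 't and P :: "('t, 'v) arc list set"
    and X :: real and \<delta>' :: "('t, 'v) arc list \<Rightarrow> real"
  assumes "finite T" and "finite V"
    and "\<And>v. v \<in> V \<Longrightarrow> E v \<subseteq> T \<times> T"
    and "\<And>a. a \<in> arcs (token_multigraph T V E) \<Longrightarrow> admissible (\<phi> a)"
    and "finite P" and "P \<noteq> {}"
    and "\<And>p. p \<in> P \<Longrightarrow> pre_digraph.awalk (token_multigraph T V E) s p d"
    and "X > 0"
    and "allocation P X \<delta>'"
  shows "is_arg_max (total_output \<phi> P) (allocation P X) \<delta>' \<longleftrightarrow>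
    (\<exists>l::real.
      (\<forall>p\<in>P. \<delta>' p > 0 \<longrightarrow> (path_exchange \<phi> p has_real_derivative l) (at (\<delta>' p))) \<and>
      (\<forall>p\<in>P. \<delta>' p = 0 \<longrightarrow>
        (\<exists>D. (path_exchange \<phi> p has_real_derivative D) (at_right 0) \<and> D \<le> l)))"
proof -
  let ?y = "path_exchange \<phi>"
  have adm: "admissible (?y p)" if "p \<in> P" for p
  proof (rule admissible_path_exchange)
    fix a
    assume "a \<in> set p"
    then show "admissible (\<phi> a)"
      using assms(4)[of a] assms(7)[OF that] by (auto simp: pre_digraph.awalk_def)
  qed
  have nonneg: "\<delta>' p \<ge> 0" if "p \<in> P" for p
    using assms(9) that by (simp add: allocation_def)
  \<comment> \<open>One derivative \<open>D p\<close> is fixed for each path; \<open>pos\<close> and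
    \<open>zero\<close> then turn the two marginal conditions into conditions on
    \<open>D p\<close>.\<close>
  have "\<forall>p\<in>P. \<exists>D. (?y p has_real_derivative D) (at (\<delta>' p) within {0..})"
    using adm nonneg by (simp add: admissible_iff)
  then obtain D where D: "\<And>p. p \<in> P \<Longrightarrow> (?y p has_real_derivative D p) (at (\<delta>' p) within {0..})"
    by metis
  have pos: "(?y p has_real_derivative l) (at (\<delta>' p)) \<longleftrightarrow> D p = l"
    if "p \<in> P" "\<delta>' p > 0" for p l
    using D[OF that(1)] that(2) by (auto simp: has_derivative_at_within_Ici intro: DERIV_unique)
  have zero: "(\<exists>D. (?y p has_real_derivative D) (at_right 0) \<and> D \<le> l) \<longleftrightarrow> D p \<le> l"
    if "p \<in> P" "\<delta>' p = 0" for p l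
  proof -
    have "(?y p has_real_derivative D p) (at_right 0)"
      using D[OF that(1)] that(2) by (simp add: at_within_Ici_at_right)
    \<comment> \<open>Right derivatives at 0 are unique since \<open>at_right 0\<close> is a
      nontrivial filter, so the existential speaks of \<open>D p\<close> alone.\<close>
    moreover have "D p = C" if "(?y p has_real_derivative C) (at_right 0)" for C
      using calculation that trivial_limit_at_right_real[of 0]
      by (auto simp: has_field_derivative_iff trivial_limit_def intro: tendsto_unique)
    ultimately show ?thesis by blast
  qed
  have "is_arg_max (total_output \<phi> P) (allocation P X) \<delta>' \<longleftrightarrow>
      (\<exists>l. \<forall>p\<in>P. (\<delta>' p > 0 \<longrightarrow> D p = l) \<and> (\<delta>' p = 0 \<longrightarrow> D p \<le> l))"
    unfolding total_output_def
    using assms(5,8,9) adm D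
    by (intro is_arg_max_allocation_iff) (auto simp: admissible_iff)
  also have "\<dots> \<longleftrightarrow> (\<exists>l::real.
      (\<forall>p\<in>P. \<delta>' p > 0 \<longrightarrow> (path_exchange \<phi> p has_real_derivative l) (at (\<delta>' p))) \<and>
      (\<forall>p\<in>P. \<delta>' p = 0 \<longrightarrow>
        (\<exists>D. (path_exchange \<phi> p has_real_derivative D) (at_right 0) \<and> D \<le> l)))"
    using pos zero by (simp add: ball_conj_distrib cong: conj_cong)
  finally show ?thesis .
qed

end
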